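(* Let $k$ be a fixed positive integer and let $\nu \in (0,1/2)$. For all $m,n$ large enough (depending on $k,\nu$) with $m \le 2\sqrt{\nu n}/k$, $$\inf_{\Psi}\ \max\big\{\mathbf{P}_{\text{unif}}(\Psi(\phi)=1),\ \mathbf{P}_{\text{planted}}(\Psi(\phi)=0)\big\} \ \ge\ \frac12 - \nu,$$ where the infimum is over all tests, i.e. all functions $\Psi:\mathcal{F}^k_{n,m}\to\{0,1\}$.
   Context: Formulas: for positive integers $n,m$ and a fixed positive integer $k$ (with $n \ge k$), $\mathcal{F}^k_{n,m}$ is the set of boolean formulas $\phi = \bigwedge_{i=1}^m C_i$ on $n$ variables $x_1,\dots,x_n$, where each clause $C_i = \ell_{i,1}\vee\dots\vee \ell_{i,k}$ is a disjunction of $k$ literals ($\ell_{i,j}\in\{x_1,\bar x_1,\dots,x_n,\bar x_n\}$) on $k$ distinct variables. The formula is regarded as a sequence of $m$ clauses (clauses may repeat), and there are $2^k\binom{n}{k}$ possible clauses up to the order of literals; each clause is given with its $k$ literals in a uniformly random order. Distributions on $\mathcal{F}^k_{n,m}$: under $\mathbf{P}_{\text{unif}}$, the $m$ clauses are independent and uniform among the $2^k\binom{n}{k}$ possible clauses. For $x\in\{0,1\}^n$, under $\mathbf{P}_x$ the $m$ clauses are independent and uniform among the $(2^k-1)\binom{n}{k}$ clauses satisfied by $x$. The planted distribution is the mixture $\mathbf{P}_{\text{planted}} = 2^{-n}\sum_{x\in\{0,1\}^n}\mathbf{P}_x$. *)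

theory Defs
  imports "HOL-Probability.Probability" "HOL-Combinatorics.Multiset_Permutations"
begin

text \<open>The literal \<open>x\<^sub>i\<close> is encoded as \<open>(i, True)\<close> and its negation as \<open>(i, False)\<close>.\<close>

type_synonym literal = "nat \<times> bool"

type_synonym assignment = "nat \<Rightarrow> bool"

definition assignments :: "nat \<Rightarrow> assignment set" where
  "assignments n = {1..n} \<rightarrow>\<^sub>E UNIV"

text \<open>Clauses up to the order of literals: sets of \<open>k\<close> literals on pairwise distinct
  variables among \<open>x\<^sub>1, \<dots>, x\<^sub>n\<close>. There are \<open>2 ^ k * (n choose k)\<close> of them.\<close>

definition clauses :: "nat \<Rightarrow> nat \<Rightarrow> literal set set" where
  "clauses k n = {C. C \<subseteq> {1..n} \<times> UNIV \<and> card C = k \<and> inj_on fst C}"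

definition satisfies :: "assignment \<Rightarrow> literal set \<Rightarrow> bool" where
  "satisfies x C \<longleftrightarrow> (\<exists>(i, b) \<in> C. x i = b)"

text \<open>A formula is a sequence of \<open>m\<close> clauses, each of them presented as a list, that is, with
  its literals in some order.\<close>

definition formulas :: "nat \<Rightarrow> nat \<Rightarrow> nat \<Rightarrow> literal list list set" where
  "formulas k n m =
     {\<phi>. length \<phi> = m \<and> set \<phi> \<subseteq> (\<Union>C\<in>clauses k n. permutations_of_set C)}"

definition random_order :: "'a set \<Rightarrow> 'a list pmf" where
  "random_order C = pmf_of_set (permutations_of_set C)"

text \<open>\<open>pmf_of_set\<close> is only meaningful on nonempty finite sets; the sets of clauses used below
  are nonempty when \<open>1 \<le> k\<close> and \<open>k \<le> n\<close>.\<close>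

definition P_unif :: "nat \<Rightarrow> nat \<Rightarrow> nat \<Rightarrow> literal list list pmf" where
  "P_unif k n m = replicate_pmf m (bind_pmf (pmf_of_set (clauses k n)) random_order)"

definition P_sat :: "nat \<Rightarrow> nat \<Rightarrow> nat \<Rightarrow> assignment \<Rightarrow> literal list list pmf" where
  "P_sat k n m x =
     replicate_pmf m (bind_pmf (pmf_of_set {C \<in> clauses k n. satisfies x C}) random_order)"

definition P_planted :: "nat \<Rightarrow> nat \<Rightarrow> nat \<Rightarrow> literal list list pmf" where
  "P_planted k n m = bind_pmf (pmf_of_set (assignments n)) (P_sat k n m)"

definition tests :: "nat \<Rightarrow> nat \<Rightarrow> nat \<Rightarrow> (literal list list \<Rightarrow> nat) set" where
  "tests k n m = formulas k n m \<rightarrow>\<^sub>E {0, 1}"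

end

theory Submission
  imports Defs
begin

text \<open>Call a formula good if its clauses involve pairwise disjoint sets of variables. Each clause of a
  good formula is satisfied by a fraction \<open>1 - 2 ^ (-k)\<close> of the assignments, independently of the
  other clauses; this factor cancels against the smaller number of clauses available to the planted
  distribution, so both distributions give a good formula the same probability. Two random clauses
  share a variable with probability at most \<open>k\<^sup>2 / n\<close>, so by the union bound over pairs of clauses a
  uniform formula is good with probability at least \<open>1 - m\<^sup>2 * k\<^sup>2 / (2 * n) \<ge> 1 - 2 * \<nu>\<close>. The two
  error probabilities of a test therefore add up to at least \<open>1 - 2 * \<nu>\<close>.\<close>

section \<open>Counting clauses by the set of their variables\<close>

lemma card_clauses_on:
  assumes "finite S"
  shows "card {C :: literal set. fst ` C = S \<and> inj_on fst C} = 2 ^ card S"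
proof -
  \<comment> \<open>A clause on \<open>S\<close> is the graph of a choice of signs \<open>f\<close>.
    The inverse reads off the sign of \<open>i\<close> from the membership of
    \<open>(i, True)\<close>, restricted to \<open>S\<close> so that the result is
    extensional.\<close>
  have "bij_betw (\<lambda>f. (\<lambda>i. (i, f i)) ` S) (S \<rightarrow>\<^sub>E (UNIV :: bool set))
      {C :: literal set. fst ` C = S \<and> inj_on fst C}"
  proof (rule bij_betw_byWitness[where f' = "\<lambda>C. \<lambda>i\<in>S. (i, True) \<in> C"])
    show "\<forall>f\<in>S \<rightarrow>\<^sub>E UNIV. (\<lambda>i\<in>S. (i, True) \<in> (\<lambda>i. (i, f i)) ` S) = f"
      by (auto simp: fun_eq_iff restrict_def PiE_def extensional_def)
    show "\<forall>C\<in>{C :: literal set. fst ` C = S \<and> inj_on fst C}.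
        (\<lambda>i. (i, (\<lambda>i\<in>S. (i, True) \<in> C) i)) ` S = C"
    proof
      fix C :: "literal set" assume C: "C \<in> {C. fst ` C = S \<and> inj_on fst C}"
      have uniq: "b = b'" if "(i, b) \<in> C" "(i, b') \<in> C" for i b b'
        using C that inj_onD[of fst C "(i, b)" "(i, b')"] by simp
      have "(i, b) \<in> (\<lambda>i. (i, (\<lambda>i\<in>S. (i, True) \<in> C) i)) ` S \<longleftrightarrow> (i, b) \<in> C" for i b
      proof -
        have "(\<exists>b. (i, b) \<in> C) \<longleftrightarrow> i \<in> S"
          using C by force
        then show ?thesis
          using uniq[of i] by (cases b) (auto simp: image_iff, metis+)
      qed
      then show "(\<lambda>i. (i, (\<lambda>i\<in>S. (i, True) \<in> C) i)) ` S = C"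
        by auto
    qed
    show "(\<lambda>f. (\<lambda>i. (i, f i)) ` S) ` (S \<rightarrow>\<^sub>E UNIV) \<subseteq> {C. fst ` C = S \<and> inj_on fst C}"
      by (auto simp: inj_on_def image_image)
  qed auto
  then have "card (S \<rightarrow>\<^sub>E (UNIV :: bool set)) = card {C :: literal set. fst ` C = S \<and> inj_on fst C}"
    by (rule bij_betw_same_card)
  then show ?thesis
    using assms by (simp add: card_PiE)
qed

lemma finite_clauses_on:
  "finite S \<Longrightarrow> finite {C :: literal set. fst ` C = S \<and> inj_on fst C \<and> P C}"
  by (rule finite_subset[of _ "Pow (S \<times> UNIV)"]) (auto intro: rev_image_eqI)

text \<open>To be falsified by \<open>x\<close>, a clause must disagree with \<open>x\<close> in
  every literal, which determines all signs once the variables are fixed.\<close>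

lemma unsatisfied_clauses_on:
  "{C. fst ` C = S \<and> inj_on fst C \<and> \<not> satisfies x C} = {(\<lambda>i. (i, \<not> x i)) ` S}"
proof (intro set_eqI iffI)
  fix C assume "C \<in> {C. fst ` C = S \<and> inj_on fst C \<and> \<not> satisfies x C}"
  then have S: "fst ` C = S" and ns: "\<And>i b. (i, b) \<in> C \<Longrightarrow> b = (\<not> x i)"
    by (auto simp: satisfies_def)
  have "C = (\<lambda>i. (i, \<not> x i)) ` fst ` C"
    using ns by (force simp: image_iff)
  then show "C \<in> {(\<lambda>i. (i, \<not> x i)) ` S}" using S by simp
qed (auto simp: satisfies_def inj_on_def image_image)

lemma card_satisfied_clauses_on:
  assumes "finite S"
  shows "card {C. fst ` C = S \<and> inj_on fst C \<and> satisfies x C} = 2 ^ card S - 1"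
proof -
  have "{C. fst ` C = S \<and> inj_on fst C \<and> satisfies x C}
      = {C. fst ` C = S \<and> inj_on fst C} - {C. fst ` C = S \<and> inj_on fst C \<and> \<not> satisfies x C}"
    by auto
  also have "card \<dots> = card {C :: literal set. fst ` C = S \<and> inj_on fst C}
      - card {C. fst ` C = S \<and> inj_on fst C \<and> \<not> satisfies x C}"
    by (rule card_Diff_subset) (auto simp: finite_clauses_on[OF assms])
  finally show ?thesis
    by (simp add: card_clauses_on[OF assms] unsatisfied_clauses_on)
qed

text \<open>Grouping clauses by variable set turns each global count into a sum of local ones. The
  predicate \<open>P\<close> is left open to serve three counts: all clauses, those satisfied by
  \<open>x\<close>, and those through a given variable.\<close>

lemma clauses_eq_UN:
  "{C \<in> clauses k n. P C} =
    (\<Union>S\<in>{S. S \<subseteq> {1..n} \<and> card S = k}. {C. fst ` C = S \<and> inj_on fst C \<and> P C})"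
proof -
  have "C \<subseteq> {1..n} \<times> UNIV \<longleftrightarrow> fst ` C \<subseteq> {1..n}" for C :: "literal set"
    by force
  then show ?thesis
    by (auto simp: clauses_def card_image simp del: atLeastAtMost_iff)
qed

lemma card_clauses_eq_sum:
  assumes "\<And>S. S \<subseteq> {1..n} \<Longrightarrow> card S = k \<Longrightarrow>
    card {C. fst ` C = S \<and> inj_on fst C \<and> P C} = c S"
  shows "card {C \<in> clauses k n. P C} = (\<Sum>S | S \<subseteq> {1..n} \<and> card S = k. c S)"
proof -
  have "card {C \<in> clauses k n. P C} =
    (\<Sum>S | S \<subseteq> {1..n} \<and> card S = k. card {C. fst ` C = S \<and> inj_on fst C \<and> P C})"
    unfolding clauses_eq_UN
    by (rule card_UN_disjoint) (auto intro: finite_clauses_on dest: finite_subset)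
  then show ?thesis using assms by simp
qed

lemma finite_clauses: "finite (clauses k n)"
  by (rule finite_subset[of _ "Pow ({1..n} \<times> UNIV)"]) (auto simp: clauses_def)

lemma card_clauses: "card (clauses k n) = 2 ^ k * (n choose k)"
proof -
  have "card {C \<in> clauses k n. True} = (\<Sum>S | S \<subseteq> {1..n} \<and> card S = k. 2 ^ k)"
    by (rule card_clauses_eq_sum) (auto simp: card_clauses_on dest: finite_subset)
  then show ?thesis by (simp add: n_subsets)
qed

lemma card_satisfied_clauses:
  "card {C \<in> clauses k n. satisfies x C} = (2 ^ k - 1) * (n choose k)"
proof -
  have "card {C \<in> clauses k n. satisfies x C} = (\<Sum>S | S \<subseteq> {1..n} \<and> card S = k. 2 ^ k - 1)"
    by (rule card_clauses_eq_sum) (auto simp: card_satisfied_clauses_on dest: finite_subset)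
  then show ?thesis by (simp add: n_subsets)
qed

lemma card_clauses_through:
  assumes "v \<in> {1..n}" "k \<ge> 1"
  shows "card {C \<in> clauses k n. v \<in> fst ` C} = 2 ^ k * ((n - 1) choose (k - 1))"
proof -
  have "card {C \<in> clauses k n. v \<in> fst ` C} =
      (\<Sum>S | S \<subseteq> {1..n} \<and> card S = k. if v \<in> S then 2 ^ k else 0)"
  proof (rule card_clauses_eq_sum)
    fix S assume S: "S \<subseteq> {1..n}" "card S = k"
    have "{C :: literal set. fst ` C = S \<and> inj_on fst C \<and> v \<in> fst ` C} =
      (if v \<in> S then {C. fst ` C = S \<and> inj_on fst C} else {})"
      by auto
    then show "card {C :: literal set. fst ` C = S \<and> inj_on fst C \<and> v \<in> fst ` C} =
        (if v \<in> S then 2 ^ k else 0)"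
      using S card_clauses_on[of S] by (auto dest: finite_subset)
  qed
  also have "\<dots> = 2 ^ k * card {S. S \<subseteq> {1..n} \<and> card S = k \<and> v \<in> S}"
    by (simp add: sum.If_cases Collect_conj_eq Int_assoc)
  also have "card {S. S \<subseteq> {1..n} \<and> card S = k \<and> v \<in> S} = (n - 1) choose (k - 1)"
  proof -
    \<comment> \<open>The sets that avoid \<open>v\<close> are the \<open>k\<close>-subsets of the
      other \<open>n - 1\<close> variables; Pascal's rule evaluates the difference at the
      end.\<close>
    have "{S. S \<subseteq> {1..n} \<and> card S = k \<and> v \<in> S} =
      {S. S \<subseteq> {1..n} \<and> card S = k} - {S. S \<subseteq> {1..n} - {v} \<and> card S = k}"
      by auto
    also have "card \<dots> = card {S. S \<subseteq> {1..n} \<and> card S = k}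
        - card {S. S \<subseteq> {1..n} - {v} \<and> card S = k}"
      by (rule card_Diff_subset) (auto intro: finite_subset[of _ "Pow {1..n}"])
    also have "\<dots> = (n choose k) - ((n - 1) choose k)"
      using assms by (simp add: n_subsets)
    finally show ?thesis
      using assms by (cases n; cases k) auto
  qed
  finally show ?thesis .
qed

section \<open>Counting assignments that satisfy clauses on disjoint variables\<close>

lemma card_PiE_split:
  fixes P Q :: "('a \<Rightarrow> 'b) \<Rightarrow> bool"
  assumes "W \<subseteq> V"
    and P: "\<And>f g. (\<And>i. i \<in> W \<Longrightarrow> f i = g i) \<Longrightarrow> P f = P g"
    and Q: "\<And>f g. (\<And>i. i \<in> V - W \<Longrightarrow> f i = g i) \<Longrightarrow> Q f = Q g"
  shows "card {f \<in> V \<rightarrow>\<^sub>E B. P f \<and> Q f} =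
    card {f \<in> W \<rightarrow>\<^sub>E B. P f} * card {f \<in> V - W \<rightarrow>\<^sub>E B. Q f}"
proof -
  let ?join = "\<lambda>(f, g) i. if i \<in> W then f i else g i"
  \<comment> \<open>Restricting to the two blocks of variables is inverse to gluing. Since
    \<open>P\<close> and \<open>Q\<close> each look at one block only, the joint condition becomes a
    product.\<close>
  have "bij_betw (\<lambda>f. (restrict f W, restrict f (V - W))) {f \<in> V \<rightarrow>\<^sub>E B. P f \<and> Q f}
     ({f \<in> W \<rightarrow>\<^sub>E B. P f} \<times> {f \<in> V - W \<rightarrow>\<^sub>E B. Q f})"
  proof (rule bij_betw_byWitness[where f' = ?join])
    show "\<forall>f\<in>{f \<in> V \<rightarrow>\<^sub>E B. P f \<and> Q f}. ?join (restrict f W, restrict f (V - W)) = f"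
      using assms(1) by (auto simp: fun_eq_iff PiE_def extensional_def)
    show "\<forall>p\<in>{f \<in> W \<rightarrow>\<^sub>E B. P f} \<times> {f \<in> V - W \<rightarrow>\<^sub>E B. Q f}.
        (restrict (?join p) W, restrict (?join p) (V - W)) = p"
      by (auto simp: fun_eq_iff PiE_def extensional_def)
    have "P (restrict f W) = P f" "Q (restrict f (V - W)) = Q f" for f
      by (rule P Q; simp)+
    then show "(\<lambda>f. (restrict f W, restrict f (V - W))) ` {f \<in> V \<rightarrow>\<^sub>E B. P f \<and> Q f}
        \<subseteq> {f \<in> W \<rightarrow>\<^sub>E B. P f} \<times> {f \<in> V - W \<rightarrow>\<^sub>E B. Q f}"
      using assms(1) by auto
    have "P (?join (f, g)) = P f" "Q (?join (f, g)) = Q g" for f g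
      by (rule P Q; simp)+
    then show "?join ` ({f \<in> W \<rightarrow>\<^sub>E B. P f} \<times> {f \<in> V - W \<rightarrow>\<^sub>E B. Q f})
        \<subseteq> {f \<in> V \<rightarrow>\<^sub>E B. P f \<and> Q f}"
      using assms(1) by (auto simp: PiE_def extensional_def Pi_def)
  qed
  then show ?thesis
    by (simp add: bij_betw_same_card card_cartesian_product)
qed

lemma satisfies_cong:
  assumes "\<And>i. i \<in> fst ` C \<Longrightarrow> f i = g i"
  shows "satisfies f C = satisfies g C"
proof -
  have "f i = g i" if "(i, b) \<in> C" for i b
    using that by (intro assms) (auto intro: rev_image_eqI)
  then show ?thesis
    by (auto simp: satisfies_def)
qed

lemma card_satisfying_clause:
  assumes "finite C" "inj_on fst C"
  shows "card {f \<in> fst ` C \<rightarrow>\<^sub>E UNIV. satisfies f C} = 2 ^ card C - 1"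
proof -
  let ?W = "fst ` C"
  have uniq: "b = b'" if "(i, b) \<in> C" "(i, b') \<in> C" for i b b'
    using that inj_onD[OF assms(2), of "(i, b)" "(i, b')"] by simp
  \<comment> \<open>Falsifying \<open>C\<close> forces every one of its variables: it must be true
    exactly when its negation occurs in \<open>C\<close>. Hence one assignment out of 2^k is
    lost.\<close>
  have unsat: "{f \<in> ?W \<rightarrow>\<^sub>E UNIV. \<not> satisfies f C} = {\<lambda>i\<in>?W. (i, False) \<in> C}"
  proof (intro set_eqI iffI)
    fix f assume "f \<in> {f \<in> ?W \<rightarrow>\<^sub>E UNIV. \<not> satisfies f C}"
    then have ext: "f \<in> extensional ?W" and ns: "\<And>i b. (i, b) \<in> C \<Longrightarrow> f i = (\<not> b)"
      by (auto simp: satisfies_def PiE_def)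
    have "f i = ((i, False) \<in> C)" if "i \<in> ?W" for i
    proof -
      from that obtain b where "(i, b) \<in> C" by auto
      then show ?thesis using ns[of i b] uniq[of i] by (cases b) auto
    qed
    with ext show "f \<in> {\<lambda>i\<in>?W. (i, False) \<in> C}"
      by (auto simp: fun_eq_iff extensional_def)
  next
    fix f assume f: "f \<in> {\<lambda>i\<in>?W. (i, False) \<in> C}"
    have "f i \<noteq> b" if "(i, b) \<in> C" for i b
    proof -
      have "i \<in> ?W" using that by force
      then show ?thesis using f that uniq[OF that, of "\<not> b"] by (cases b) auto
    qed
    then show "f \<in> {f \<in> ?W \<rightarrow>\<^sub>E UNIV. \<not> satisfies f C}"
      using f by (auto simp: satisfies_def)
  qed
  have fin: "finite (?W \<rightarrow>\<^sub>E (UNIV :: bool set))"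
    using assms by (intro finite_PiE) auto
  have "{f \<in> ?W \<rightarrow>\<^sub>E UNIV. satisfies f C} =
      (?W \<rightarrow>\<^sub>E UNIV) - {f \<in> ?W \<rightarrow>\<^sub>E UNIV. \<not> satisfies f C}"
    by auto
  also have "card \<dots> = card (?W \<rightarrow>\<^sub>E (UNIV :: bool set)) - card {f \<in> ?W \<rightarrow>\<^sub>E UNIV. \<not> satisfies f C}"
    using fin by (intro card_Diff_subset) auto
  finally show ?thesis
    using assms by (simp add: unsat card_PiE card_image)
qed

text \<open>Disjoint clauses constrain separate blocks of variables, so each one multiplies the
  satisfying fraction by (2^k - 1) / 2^k. The identity is cleared of denominators to stay in the
  natural numbers. The induction varies \<open>V\<close>, since the variables of the first clause
  are removed from it.\<close>

lemma card_satisfying_disjoint_clauses: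
  assumes "finite V"
    and "sorted_wrt (\<lambda>C D. disjnt (fst ` C) (fst ` D)) Cs"
    and "\<And>C. C \<in> set Cs \<Longrightarrow> finite C \<and> inj_on fst C \<and> card C = k \<and> fst ` C \<subseteq> V"
  shows "card {f \<in> V \<rightarrow>\<^sub>E UNIV. \<forall>C\<in>set Cs. satisfies f C} * 2 ^ (k * length Cs) =
    2 ^ card V * (2 ^ k - 1) ^ length Cs"
  using assms
proof (induction Cs arbitrary: V)
  case Nil
  then show ?case by (simp add: card_PiE)
next
  case (Cons C Cs)
  let ?W = "fst ` C"
  have C: "finite C" "inj_on fst C" "card C = k" "?W \<subseteq> V"
    using Cons.prems(3)[of C] by auto
  have sub: "fst ` D \<subseteq> V - ?W" if "D \<in> set Cs" for D
    using that Cons.prems(2) Cons.prems(3)[of D] by (auto simp: disjnt_def)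
  have "{f \<in> V \<rightarrow>\<^sub>E UNIV. \<forall>D\<in>set (C # Cs). satisfies f D} =
      {f \<in> V \<rightarrow>\<^sub>E UNIV. satisfies f C \<and> (\<forall>D\<in>set Cs. satisfies f D)}"
    by simp
  also have "card \<dots> = card {f \<in> ?W \<rightarrow>\<^sub>E UNIV. satisfies f C} *
      card {f \<in> V - ?W \<rightarrow>\<^sub>E UNIV. \<forall>D\<in>set Cs. satisfies f D}"
  proof (rule card_PiE_split[OF C(4)])
    show "satisfies f C = satisfies g C" if "\<And>i. i \<in> ?W \<Longrightarrow> f i = g i" for f g
      using that by (rule satisfies_cong)
    show "(\<forall>D\<in>set Cs. satisfies f D) = (\<forall>D\<in>set Cs. satisfies g D)"
      if "\<And>i. i \<in> V - ?W \<Longrightarrow> f i = g i" for f g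
      using that sub by (intro ball_cong refl satisfies_cong) blast
  qed
  also have "card {f \<in> ?W \<rightarrow>\<^sub>E UNIV. satisfies f C} = 2 ^ k - 1"
    using card_satisfying_clause[OF C(1,2)] C(3) by simp
  finally have step: "card {f \<in> V \<rightarrow>\<^sub>E UNIV. \<forall>D\<in>set (C # Cs). satisfies f D} =
      (2 ^ k - 1) * card {f \<in> V - ?W \<rightarrow>\<^sub>E UNIV. \<forall>D\<in>set Cs. satisfies f D}" .
  have IH: "card {f \<in> V - ?W \<rightarrow>\<^sub>E UNIV. \<forall>D\<in>set Cs. satisfies f D} * 2 ^ (k * length Cs) =
      2 ^ card (V - ?W) * (2 ^ k - 1) ^ length Cs"
    using Cons.prems sub by (intro Cons.IH) auto
  have "card ?W = k"
    using C by (simp add: card_image)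
  then have "card V = k + card (V - ?W)"
    using card_Un_disjoint[of ?W "V - ?W"] C Cons.prems(1) by (simp add: Un_absorb1)
  then show ?case
    unfolding step using IH by (simp add: power_add algebra_simps)
qed

section \<open>Sequences of independent draws\<close>

lemma replicate_pmf_Suc_pair:
  "replicate_pmf (Suc n) p = map_pmf (\<lambda>(x, xs). x # xs) (pair_pmf p (replicate_pmf n p))"
  by (simp add: pair_pmf_def map_pmf_def bind_assoc_pmf bind_return_pmf)

lemma pmf_replicate_pmf: "pmf (replicate_pmf (length xs) p) xs = (\<Prod>x\<leftarrow>xs. pmf p x)"
proof (induction xs)
  case (Cons x xs)
  have "inj (\<lambda>(x :: 'a, xs). x # xs)"
    by (auto simp: inj_on_def)
  from pmf_map_inj'[OF this, of "pair_pmf p (replicate_pmf (length xs) p)" "(x, xs)"] Cons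
  show ?case
    by (simp add: replicate_pmf_Suc_pair pmf_pair del: replicate_pmf.simps)
qed simp

lemma measure_bind_pmf_le:
  assumes "\<And>x. x \<in> set_pmf p \<Longrightarrow> measure_pmf.prob (q x) A \<le> c"
  shows "measure_pmf.prob (bind_pmf p q) A \<le> c"
proof -
  \<comment> \<open>The bound \<open>c\<close> must be shown nonnegative before passing to
    \<open>ennreal\<close>, which sends negative reals to 0.\<close>
  obtain x where "x \<in> set_pmf p" using set_pmf_not_empty by fast
  with assms[OF this] have c: "0 \<le> c"
    using measure_nonneg order_trans by blast
  have "emeasure (bind_pmf p q) A = (\<integral>\<^sup>+ x. emeasure (q x) A \<partial>p)"
    by simp
  also have "\<dots> \<le> (\<integral>\<^sup>+ x. ennreal c \<partial>p)"
    using assms c by (intro nn_integral_mono_AE)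
      (auto simp: AE_measure_pmf_iff measure_pmf.emeasure_eq_measure ennreal_leI)
  finally show ?thesis
    using c by (simp add: measure_pmf.emeasure_eq_measure)
qed

text \<open>Union bound over the m(m - 1)/2 pairs of positions. In the induction the new first entry
  conflicts with one of the \<open>m\<close> later ones with probability at most m \<epsilon>, and
  m(m - 1)/2 + m = (m + 1)m/2.\<close>

lemma prob_not_pairwise_le:
  assumes "\<And>y. y \<in> set_pmf p \<Longrightarrow> measure_pmf.prob p {x. \<not> R x y} \<le> \<epsilon>"
  shows "measure_pmf.prob (replicate_pmf m p) {xs. \<not> sorted_wrt R xs} \<le> real m * (real m - 1) / 2 * \<epsilon>"
proof (induction m)
  case (Suc m)
  let ?q = "replicate_pmf m p"
  let ?A = "{xs. \<not> sorted_wrt R xs}"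
  let ?B = "{(x, xs). \<exists>y\<in>set xs. \<not> R x y}"
  have later: "measure_pmf.prob (pair_pmf p ?q) ?B \<le> real m * \<epsilon>"
  proof -
    \<comment> \<open>Drawing the tail first makes it fixed, so that the hypothesis applies to the
      random head against each given later entry.\<close>
    have "pair_pmf p ?q = bind_pmf ?q (\<lambda>xs. map_pmf (\<lambda>x. (x, xs)) p)"
      unfolding pair_pmf_def map_pmf_def by (rule bind_commute_pmf)
    moreover have "measure_pmf.prob (map_pmf (\<lambda>x. (x, xs)) p) ?B \<le> real m * \<epsilon>"
      if "xs \<in> set_pmf ?q" for xs
    proof -
      have xs: "set xs \<subseteq> set_pmf p" "length xs = m"
        using that by (auto simp: set_replicate_pmf)
      have "measure_pmf.prob p {x. \<exists>y\<in>set ys. \<not> R x y} \<le> real (length ys) * \<epsilon>"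
        if "set ys \<subseteq> set_pmf p" for ys
        using that
      proof (induction ys)
        case (Cons y ys)
        have "{x. \<exists>z\<in>set (y # ys). \<not> R x z} = {x. \<not> R x y} \<union> {x. \<exists>z\<in>set ys. \<not> R x z}"
          by auto
        then have "measure_pmf.prob p {x. \<exists>z\<in>set (y # ys). \<not> R x z} \<le>
            measure_pmf.prob p {x. \<not> R x y} + measure_pmf.prob p {x. \<exists>z\<in>set ys. \<not> R x z}"
          by (simp add: measure_Un_le)
        with Cons assms[of y] show ?case by (simp add: algebra_simps)
      qed simp
      from this[of xs] xs show ?thesis by (simp add: vimage_def)
    qed
    ultimately show ?thesis by (simp add: measure_bind_pmf_le)
  qed
  have "measure_pmf.prob (replicate_pmf (Suc m) p) ?A =
      measure_pmf.prob (pair_pmf p ?q) (snd -` ?A \<union> ?B)"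
    unfolding replicate_pmf_Suc_pair measure_map_pmf
    by (intro arg_cong2[where f = measure] refl) auto
  also have "\<dots> \<le> measure_pmf.prob (pair_pmf p ?q) (snd -` ?A) + measure_pmf.prob (pair_pmf p ?q) ?B"
    by (simp add: measure_Un_le)
  also have "measure_pmf.prob (pair_pmf p ?q) (snd -` ?A) = measure_pmf.prob ?q ?A"
    by (simp only: measure_map_pmf[symmetric] map_snd_pair_pmf)
  finally show ?case
    using Suc later by (simp add: field_simps)
qed simp

lemma measure_pmf_eqI:
  assumes "finite A" "\<And>x. x \<in> A \<Longrightarrow> pmf p x = pmf q x"
  shows "measure_pmf.prob p A = measure_pmf.prob q A"
  using assms by (simp add: measure_measure_pmf_finite)

section \<open>The law of a single clause in random order\<close>

definition ordered_clause :: "literal set set \<Rightarrow> literal list pmf" where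
  "ordered_clause A = bind_pmf (pmf_of_set A) random_order"

lemma pmf_random_order:
  "finite C \<Longrightarrow> pmf (random_order C) l = (if distinct l \<and> set l = C then 1 / fact (card C) else 0)"
  by (auto simp: random_order_def permutations_of_set_def[of C, symmetric] indicator_def
      dest: permutations_of_setD)

text \<open>A list can only come from the clause formed by its own literals, so the mixture over
  \<open>A\<close> collapses to a single term.\<close>

lemma pmf_ordered_clause:
  assumes "finite A" "A \<noteq> {}" "\<And>C. C \<in> A \<Longrightarrow> finite C \<and> card C = k" "distinct l"
  shows "pmf (ordered_clause A) l = (if set l \<in> A then 1 / (real (card A) * fact k) else 0)"
proof -
  have "(\<Sum>C\<in>A. pmf (random_order C) l) = (\<Sum>C\<in>A. if C = set l then 1 / fact k else 0)"
    using assms by (intro sum.cong) (auto simp: pmf_random_order)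
  then show ?thesis
    using assms by (simp add: ordered_clause_def pmf_bind_pmf_of_set sum.delta)
qed

text \<open>Reduces events that ignore the order of the literals to counting clauses.\<close>

lemma map_set_ordered_clause:
  assumes "finite A" "A \<noteq> {}" "\<And>C. C \<in> A \<Longrightarrow> finite C"
  shows "map_pmf set (ordered_clause A) = pmf_of_set A"
proof -
  have "map_pmf set (random_order C) = return_pmf C" if "finite C" for C :: "literal set"
  proof -
    have "map_pmf set (random_order C) = map_pmf (\<lambda>_. C) (random_order C)"
      using that by (intro map_pmf_cong) (auto simp: random_order_def dest: permutations_of_setD)
    then show ?thesis by simp
  qed
  then have "map_pmf set (ordered_clause A) = bind_pmf (pmf_of_set A) return_pmf"
    unfolding ordered_clause_def map_bind_pmf using assms
    by (intro bind_pmf_cong) (auto simp: set_pmf_of_set)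
  then show ?thesis by (simp add: bind_return_pmf')
qed

lemma finite_clause: "C \<in> clauses k n \<Longrightarrow> finite C"
  by (rule finite_subset[of _ "{1..n} \<times> UNIV"]) (auto simp: clauses_def)

lemma card_clause: "C \<in> clauses k n \<Longrightarrow> card C = k"
  by (simp add: clauses_def)

lemma set_ordered_clause:
  assumes "k \<ge> 1" "k \<le> n"
  shows "set_pmf (ordered_clause (clauses k n)) = (\<Union>C\<in>clauses k n. permutations_of_set C)"
proof -
  have "card (clauses k n) > 0"
    using assms by (simp add: card_clauses)
  then have "clauses k n \<noteq> {}" by auto
  then show ?thesis
    by (simp add: ordered_clause_def random_order_def finite_clauses finite_clause)
qed

text \<open>Union bound over the variables in \<open>W\<close>: each of them occurs in a fraction
  k/n of all clauses, because k (n choose k) = n (n - 1 choose k - 1).\<close>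

lemma prob_ordered_clause_meets:
  assumes "k \<ge> 1" "k \<le> n" "W \<subseteq> {1..n}"
  shows "measure_pmf.prob (ordered_clause (clauses k n)) {l. \<not> disjnt (fst ` set l) W}
    \<le> real (card W) * real k / real n"
proof -
  let ?A = "clauses k n"
  have pos: "card ?A > 0"
    using assms by (simp add: card_clauses)
  then have ne: "?A \<noteq> {}" by auto
  have finW: "finite W"
    using assms(3) finite_subset by blast
  have "measure_pmf.prob (ordered_clause ?A) {l. \<not> disjnt (fst ` set l) W} =
      measure_pmf.prob (map_pmf set (ordered_clause ?A)) {C. \<not> disjnt (fst ` C) W}"
    by (simp add: vimage_def)
  also have "\<dots> = real (card (?A \<inter> {C. \<not> disjnt (fst ` C) W})) / real (card ?A)"
    using ne by (simp add: map_set_ordered_clause finite_clauses finite_clause measure_pmf_of_set)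
  also have "?A \<inter> {C. \<not> disjnt (fst ` C) W} = (\<Union>v\<in>W. {C \<in> ?A. v \<in> fst ` C})"
    by (auto simp: disjnt_iff)
  also have "real (card \<dots>) \<le> real (card W * (2 ^ k * ((n - 1) choose (k - 1))))"
  proof -
    have "card (\<Union>v\<in>W. {C \<in> ?A. v \<in> fst ` C}) \<le> (\<Sum>v\<in>W. card {C \<in> ?A. v \<in> fst ` C})"
      by (rule card_UN_le[OF finW])
    also have "\<dots> = (\<Sum>v\<in>W. 2 ^ k * ((n - 1) choose (k - 1)))"
      using assms by (intro sum.cong card_clauses_through) auto
    finally show ?thesis by (simp only: of_nat_le_iff sum_constant of_nat_id)
  qed
  also have "real (card W * (2 ^ k * ((n - 1) choose (k - 1)))) / real (card ?A) =
      real (card W) * real k / real n"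
  proof -
    have "real k * real (n choose k) = real n * real ((n - 1) choose (k - 1))"
      using times_binomial_minus1_eq[of k n] assms by (simp flip: of_nat_mult)
    moreover have "real (n choose k) > 0" "real n > 0"
      using assms by simp_all
    ultimately show ?thesis
      unfolding card_clauses by (simp add: field_simps)
  qed
  finally show ?thesis using pos by (simp add: divide_right_mono)
qed

section \<open>Good formulas: their probability and the agreement of the two distributions\<close>

abbreviation disjoint_clauses :: "literal list list \<Rightarrow> bool" where
  "disjoint_clauses \<equiv> sorted_wrt (\<lambda>l l'. disjnt (fst ` set l) (fst ` set l'))"

lemma prob_disjoint_clauses:
  assumes "k \<ge> 1" "k \<le> n"
  shows "measure_pmf.prob (P_unif k n m) {\<phi>. disjoint_clauses \<phi>}
    \<ge> 1 - (real m * real k)\<^sup>2 / (2 * real n)"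
proof -
  have "measure_pmf.prob (ordered_clause (clauses k n)) {l. \<not> disjnt (fst ` set l) (fst ` set l')}
      \<le> real k * real k / real n" if "l' \<in> set_pmf (ordered_clause (clauses k n))" for l'
  proof -
    have "set l' \<in> clauses k n"
      using that by (auto simp: set_ordered_clause[OF assms] dest: permutations_of_setD)
    then have "card (fst ` set l') = k" "fst ` set l' \<subseteq> {1..n}"
      by (auto simp: clauses_def card_image)
    then show ?thesis
      using prob_ordered_clause_meets[OF assms, of "fst ` set l'"] by simp
  qed
  from prob_not_pairwise_le[OF this]
  have "measure_pmf.prob (P_unif k n m) {\<phi>. \<not> disjoint_clauses \<phi>}
      \<le> real m * (real m - 1) / 2 * (real k * real k / real n)"
    unfolding P_unif_def ordered_clause_def .
  also have "\<dots> \<le> real m * real m / 2 * (real k * real k / real n)"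
    by (intro mult_right_mono divide_right_mono mult_left_mono) auto
  also have "\<dots> = (real m * real k)\<^sup>2 / (2 * real n)"
    by (simp add: power2_eq_square)
  finally show ?thesis
    using measure_pmf.prob_compl[of "{\<phi>. disjoint_clauses \<phi>}" "P_unif k n m"]
    by (simp add: Collect_neg_eq Compl_eq_Diff_UNIV)
qed

lemma pmf_planted_eq_unif:
  assumes k: "k \<ge> 1" "k \<le> n" and \<phi>: "\<phi> \<in> formulas k n m" "disjoint_clauses \<phi>"
  shows "pmf (P_planted k n m) \<phi> = pmf (P_unif k n m) \<phi>"
proof -
  let ?A = "clauses k n" and ?X = "assignments n"
  let ?S = "\<lambda>x. {C \<in> clauses k n. satisfies x C}"
  \<comment> \<open>\<open>b\<close> counts the sequences of \<open>k\<close> distinct variables.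
    Thus 2^k b and q b are the numbers of ordered clauses available to the uniform distribution and
    to \<open>P_sat\<close>, respectively.\<close>
  define b where "b = real (n choose k) * fact k"
  define q :: real where "q = 2 ^ k - 1"
  have len: "length \<phi> = m" and cl: "\<And>l. l \<in> set \<phi> \<Longrightarrow> distinct l \<and> set l \<in> ?A"
    using \<phi>(1) by (auto simp: formulas_def permutations_of_set_def)
  have "(2 :: real) ^ k > 1"
    using k by simp
  then have q: "q > 0" by (simp add: q_def)
  have b: "b > 0" using k by (simp add: b_def)
  have qn: "real (2 ^ k - 1) = q" by (simp add: q_def of_nat_diff)
  have card_S: "real (card (?S x)) * fact k = q * b" for x
    by (simp add: card_satisfied_clauses b_def flip: qn)
  have neS: "?S x \<noteq> {}" for x
  proof
    assume "?S x = {}"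
    from card_S[of x] q b show False unfolding \<open>?S x = {}\<close> by simp
  qed
  have neA: "?A \<noteq> {}"
    using neS by blast
  have X: "finite ?X" "?X \<noteq> {}" "card ?X = 2 ^ n"
    by (auto simp: assignments_def card_PiE PiE_eq_empty_iff intro!: finite_PiE)

  have "pmf (P_unif k n m) \<phi> = (\<Prod>l\<leftarrow>\<phi>. pmf (ordered_clause ?A) l)"
    unfolding P_unif_def ordered_clause_def len[symmetric] by (rule pmf_replicate_pmf)
  also have "\<dots> = (\<Prod>l\<leftarrow>\<phi>. 1 / (2 ^ k * b))"
    using cl neA by (intro arg_cong[where f = prod_list] map_cong refl)
      (simp add: pmf_ordered_clause[where k = k] finite_clauses finite_clause card_clause card_clauses b_def)
  finally have unif: "pmf (P_unif k n m) \<phi> = (1 / (2 ^ k * b)) ^ m"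
    by (simp add: map_replicate_const len)

  \<comment> \<open>The likelihood under \<open>P_sat\<close> is the same for every \<open>x\<close>
    that satisfies the formula and 0 for the others, so averaging over \<open>x\<close> only
    requires the number \<open>?N\<close> of satisfying assignments.\<close>
  have sat: "pmf (P_sat k n m x) \<phi> =
      (if \<forall>C\<in>set (map set \<phi>). satisfies x C then (1 / (q * b)) ^ m else 0)" for x
  proof -
    have "pmf (P_sat k n m x) \<phi> = (\<Prod>l\<leftarrow>\<phi>. pmf (ordered_clause (?S x)) l)"
      unfolding P_sat_def ordered_clause_def len[symmetric] by (rule pmf_replicate_pmf)
    also have "\<dots> = (\<Prod>l\<leftarrow>\<phi>. if satisfies x (set l) then 1 / (q * b) else 0)"
    proof (intro arg_cong[where f = prod_list] map_cong refl)
      fix l assume "l \<in> set \<phi>"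
      with cl have l: "distinct l" "set l \<in> ?A" by auto
      have "pmf (ordered_clause (?S x)) l =
          (if set l \<in> ?S x then 1 / (real (card (?S x)) * fact k) else 0)"
        using neS l(1)
        by (intro pmf_ordered_clause) (auto simp: finite_clauses finite_clause card_clause)
      then show "pmf (ordered_clause (?S x)) l = (if satisfies x (set l) then 1 / (q * b) else 0)"
        using l(2) unfolding card_S by simp
    qed
    also have "\<dots> = (if \<forall>l\<in>set \<phi>. satisfies x (set l) then (1 / (q * b)) ^ length \<phi> else 0)"
      by (induction \<phi>) auto
    finally show ?thesis by (simp add: len)
  qed
  let ?N = "card {x \<in> ?X. \<forall>C\<in>set (map set \<phi>). satisfies x C}"
  have "?N * 2 ^ (k * length (map set \<phi>)) = 2 ^ card {1..n} * (2 ^ k - 1) ^ length (map set \<phi>)"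
    unfolding assignments_def
  proof (rule card_satisfying_disjoint_clauses)
    show "sorted_wrt (\<lambda>C D. disjnt (fst ` C) (fst ` D)) (map set \<phi>)"
      using \<phi>(2) by (simp add: sorted_wrt_map)
    fix C assume "C \<in> set (map set \<phi>)"
    then have "C \<in> ?A" using cl by auto
    then show "finite C \<and> inj_on fst C \<and> card C = k \<and> fst ` C \<subseteq> {1..n}"
      using finite_clause[of C k n] by (auto simp: clauses_def)
  qed simp
  then have "real (?N * 2 ^ (k * m)) = real (2 ^ n * (2 ^ k - 1) ^ m)"
    by (simp only: len length_map card_atLeastAtMost diff_Suc_1)
  then have "real ?N * 2 ^ (k * m) = 2 ^ n * q ^ m"
    by (simp only: of_nat_mult of_nat_power of_nat_numeral qn)
  then have N: "real ?N = 2 ^ n * q ^ m / 2 ^ (k * m)"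
    by (simp add: eq_divide_eq)
  have "pmf (P_planted k n m) \<phi> = (\<Sum>x\<in>?X. pmf (P_sat k n m x) \<phi>) / 2 ^ n"
    unfolding P_planted_def using X by (simp add: pmf_bind_pmf_of_set)
  also have "(\<Sum>x\<in>?X. pmf (P_sat k n m x) \<phi>) = real ?N * (1 / (q * b)) ^ m"
    unfolding sat using X(1) by (simp add: sum.If_cases Int_def)
  \<comment> \<open>The fraction \<open>?N\<close> / 2^n equals (q / 2^k)^m, which turns (1 / (q
    b))^m into the uniform likelihood (1 / (2^k b))^m.\<close>
  finally show ?thesis
    using q b unfolding N unif by (simp add: power_mult power_mult_distrib power_divide)
qed

section \<open>The lower bound for tests\<close>

lemma finite_formulas: "finite (formulas k n m)"
proof -
  have "finite (\<Union>C\<in>clauses k n. permutations_of_set C)"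
    by (simp add: finite_clauses)
  from finite_lists_length_eq[OF this, of m] show ?thesis
    by (simp add: formulas_def conj_commute)
qed

lemma P_unif_support:
  assumes "k \<ge> 1" "k \<le> n"
  shows "set_pmf (P_unif k n m) \<subseteq> formulas k n m"
  by (auto simp: P_unif_def set_replicate_pmf formulas_def set_ordered_clause[OF assms]
      simp flip: ordered_clause_def)

theorem theorem2p4:
  fixes k :: nat and \<nu> :: real
  assumes "k \<ge> 1" and "0 < \<nu>" and "\<nu> < 1 / 2"
  shows "\<exists>N::nat. \<forall>n m :: nat. n \<ge> N \<longrightarrow> m \<ge> N \<longrightarrow> real m \<le> 2 * sqrt (\<nu> * real n) / real k \<longrightarrow>
    (INF \<Psi> \<in> tests k n m.
       max (measure_pmf.prob (P_unif k n m) {\<phi> \<in> formulas k n m. \<Psi> \<phi> = 1})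
           (measure_pmf.prob (P_planted k n m) {\<phi> \<in> formulas k n m. \<Psi> \<phi> = 0}))
      \<ge> 1 / 2 - \<nu>"
\<comment> \<open>The threshold \<open>k\<close> gives n \<ge> k, which makes the sets of clauses
  nonempty. For the real infimum, \<open>cINF_greatest\<close> asks for a nonempty set of tests and
  a bound for each test.\<close>
proof (intro exI[of _ k] allI impI cINF_greatest)
  fix n m :: nat
  show "tests k n m \<noteq> {}"
    by (auto simp: tests_def PiE_eq_empty_iff)
  fix \<Psi>
  assume n: "n \<ge> k" and m: "real m \<le> 2 * sqrt (\<nu> * real n) / real k" and \<Psi>: "\<Psi> \<in> tests k n m"
  let ?F = "formulas k n m"
  let ?G = "{\<phi>. disjoint_clauses \<phi>}"
  let ?U = "measure_pmf.prob (P_unif k n m)" and ?P = "measure_pmf.prob (P_planted k n m)"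
  have npos: "real n > 0" using assms n by simp
  \<comment> \<open>Squaring the bound on \<open>m\<close> gives (m k)^2 \<le> 4 \<nu> n, so the
    failure probability (m k)^2 / (2 n) is at most 2 \<nu>.\<close>
  have "(real m * real k)\<^sup>2 \<le> (2 * sqrt (\<nu> * real n))\<^sup>2"
    using m assms(1) by (intro power_mono) (auto simp: field_simps)
  also have "\<dots> = 4 * \<nu> * real n"
    using assms by (simp add: power_mult_distrib)
  finally have "(real m * real k)\<^sup>2 / (2 * real n) \<le> 2 * \<nu>"
    using npos by (simp add: field_simps)
  then have "1 - 2 * \<nu> \<le> ?U ?G"
    using prob_disjoint_clauses[OF assms(1) n, of m] by simp
  \<comment> \<open>A test takes the values 0 and 1 only on \<open>formulas k n m\<close>, so the
    event is first cut down to this set, which carries the whole mass of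
    \<open>P_unif\<close>.\<close>
  also have "\<dots> = ?U (?F \<inter> ?G)"
    using P_unif_support[OF assms(1) n, of m]
    by (intro measure_pmf.finite_measure_eq_AE) (auto simp: AE_measure_pmf_iff)
  also have "?F \<inter> ?G = ({\<phi> \<in> ?F. \<Psi> \<phi> = 1} \<inter> ?G) \<union> ({\<phi> \<in> ?F. \<Psi> \<phi> = 0} \<inter> ?G)"
    using PiE_mem[OF \<Psi>[unfolded tests_def]] by fastforce
  also have "?U \<dots> \<le> ?U ({\<phi> \<in> ?F. \<Psi> \<phi> = 1} \<inter> ?G) + ?U ({\<phi> \<in> ?F. \<Psi> \<phi> = 0} \<inter> ?G)"
    by (rule measure_Un_le) auto
  \<comment> \<open>Change of measure on good formulas: the part on which the test answers 0 becomes
    part of the error under the planted distribution.\<close>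
  also have "?U ({\<phi> \<in> ?F. \<Psi> \<phi> = 0} \<inter> ?G) = ?P ({\<phi> \<in> ?F. \<Psi> \<phi> = 0} \<inter> ?G)"
    using assms(1) n by (intro measure_pmf_eqI) (auto simp: finite_formulas pmf_planted_eq_unif)
  also have "?U ({\<phi> \<in> ?F. \<Psi> \<phi> = 1} \<inter> ?G) + \<dots> \<le> ?U {\<phi> \<in> ?F. \<Psi> \<phi> = 1} + ?P {\<phi> \<in> ?F. \<Psi> \<phi> = 0}"
    by (intro add_mono measure_pmf.finite_measure_mono) auto
  \<comment> \<open>The two errors sum to at least 1 - 2 \<nu>, and the larger one is at least half
    the sum.\<close>
  finally show "1 / 2 - \<nu> \<le> max (?U {\<phi> \<in> ?F. \<Psi> \<phi> = 1}) (?P {\<phi> \<in> ?F. \<Psi> \<phi> = 0})"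
    by linarith
qed

end
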